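(* Let $N=2^t$ with $t\ge 1$, let $\alpha\in\mathbb{C}$, and let $\tilde{\mathbf A}_{N,\alpha}=[\alpha^{kl}]_{k,l=0}^{N-1}$ be the scaled delay Vandermonde matrix defined by the nodes $1,\alpha,\alpha^2,\dots,\alpha^{N-1}\in\mathbb{C}$. Then $$\tilde{\mathbf A}_{N,\alpha}=\mathbf P_N^T\begin{bmatrix}\tilde{\mathbf A}_{\frac N2,\alpha^2}&0\\0&\tilde{\mathbf A}_{\frac N2,\alpha^2}\end{bmatrix}\begin{bmatrix}\mathbf I_{\frac N2}&\mathbf C_{\frac N2}^{\frac N2}\\ \tilde{\mathbf D}_{\frac N2}&\alpha^{\frac N2}\,\mathbf C_{\frac N2}^{\frac N2}\,\tilde{\mathbf D}_{\frac N2}\end{bmatrix},$$ where $\mathbf P_N$ is the even-odd permutation matrix, $\tilde{\mathbf A}_{\frac N2,\alpha^2}=[\alpha^{2kl}]_{k,l=0}^{\frac N2-1}$, $\mathbf I_{\frac N2}$ is the identity matrix, $\tilde{\mathbf D}_{\frac N2}=\operatorname{diag}[\alpha^l]_{l=0}^{\frac N2-1}$, and $\mathbf C_{\frac N2}^{\frac N2}$ is the $\frac N2$-th power of the companion matrix $\mathbf C_{\frac N2}$ of the monic polynomial $p(z)=(z-1)(z-\alpha^2)(z-\alpha^4)\cdots(z-\alpha^{N-2})$.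
   Context: The even-odd permutation matrix $\mathbf P_N$ is the $N\times N$ permutation matrix with $\mathbf P_N(x_0,x_1,\dots,x_{N-1})^T=(x_0,x_2,\dots,x_{N-2},x_1,x_3,\dots,x_{N-1})^T$. The companion matrix of a monic polynomial $p(z)=z^n+\sum_{i=0}^{n-1}w_iz^i$ is the $n\times n$ matrix with ones on the first subdiagonal, last column $(-w_0,-w_1,\dots,-w_{n-1})^T$, and zeros elsewhere (for $n=1$ it is $[-w_0]$). Convention: $\alpha^0=1$. *)

theory Defs
  imports Complex_Main "HOL-Computational_Algebra.Polynomial" "Jordan_Normal_Form.Matrix"
begin

definition scaled_dvm :: "nat \<Rightarrow> complex \<Rightarrow> complex mat" where
  "scaled_dvm N \<alpha> = mat N N (\<lambda>(k, l). \<alpha> ^ (k * l))"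

text \<open>The order \<open>x\<^sub>0, x\<^sub>2, \<dots>, x\<^sub>1, x\<^sub>3, \<dots>\<close>: position \<open>i\<close> of the reordered vector
  holds the entry with index \<open>even_odd_index N i\<close>.\<close>

definition even_odd_index :: "nat \<Rightarrow> nat \<Rightarrow> nat" where
  "even_odd_index N i = (if i < N div 2 then 2 * i else 2 * (i - N div 2) + 1)"

definition even_odd_perm_mat :: "nat \<Rightarrow> complex mat" where
  "even_odd_perm_mat N = mat N N (\<lambda>(i, j). if j = even_odd_index N i then 1 else 0)"

lemma even_odd_perm_mat_mult_vec:
  assumes "even N"
  shows "even_odd_perm_mat N *\<^sub>v vec N x = vec N (\<lambda>i. x (even_odd_index N i))"
proof (rule eq_vecI)
  fix i assume "i < dim_vec (vec N (\<lambda>i. x (even_odd_index N i)))"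
  then have i: "i < N" by simp
  with assms have "even_odd_index N i < N"
    by (auto simp: even_odd_index_def elim!: evenE)
  with i show "(even_odd_perm_mat N *\<^sub>v vec N x) $ i = vec N (\<lambda>i. x (even_odd_index N i)) $ i"
    by (simp add: even_odd_perm_mat_def scalar_prod_def if_distrib[of "\<lambda>c. c * _"] cong: if_cong)
qed (simp add: even_odd_perm_mat_def)

definition companion_mat :: "complex poly \<Rightarrow> complex mat" where
  "companion_mat p = mat (degree p) (degree p)
     (\<lambda>(i, j). if j = degree p - 1 then - coeff p i else if i = j + 1 then 1 else 0)"

end

theory Submission
  imports Defs
begin

text \<open>For a root \<open>x\<close> of a monic polynomial \<open>p\<close> of degree \<open>n\<close>, the row \<open>(1, x, \<dots>, x\<^bsup>n-1\<^esup>)\<close> is a left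
  eigenvector of the companion matrix of \<open>p\<close> with eigenvalue \<open>x\<close>. With \<open>n = N/2\<close> and the roots
  \<open>\<alpha>\<^bsup>2k\<^esup>\<close>, right multiplication by the \<open>n\<close>-th power of the companion matrix therefore shifts the
  exponents of the half-size Vandermonde matrix by \<open>n\<close>, which yields its missing columns
  \<open>n, \<dots>, N-1\<close>. The upper and lower block rows then hold the even and odd rows of the full
  matrix, and the permutation interleaves them.\<close>

text \<open>Every column but the last has a single one, just below the diagonal, which raises the
  exponent by one. The last column gives minus the lower-order part of \<open>p\<close> at
  \<open>x\<close>, and this is \<open>x ^ degree p\<close> because \<open>p\<close> is monic and
  vanishes at \<open>x\<close>.\<close>

lemma companion_mat_left_eigenvector:
  assumes monic: "lead_coeff p = 1" and root: "poly p x = 0" and l: "l < degree p"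
  shows "(\<Sum>i<degree p. x ^ i * companion_mat p $$ (i, l)) = x * x ^ l"
proof (cases "l = degree p - 1")
  case True
  have "(\<Sum>i<degree p. x ^ i * companion_mat p $$ (i, l)) = - (\<Sum>i<degree p. coeff p i * x ^ i)"
    using True by (simp add: companion_mat_def sum_negf mult.commute)
  also have "\<dots> = x ^ degree p"
    using root monic by (simp add: poly_altdef minus_unique flip: lessThan_Suc_atMost)
  also have "\<dots> = x * x ^ l"
    using True l by (metis Suc_diff_1 gr_zeroI not_less_zero power_Suc)
  finally show ?thesis .
next
  case False
  have "(\<Sum>i<degree p. x ^ i * companion_mat p $$ (i, l))
      = (\<Sum>i<degree p. if i = Suc l then x ^ i else 0)"
    using False l by (intro sum.cong) (auto simp: companion_mat_def)
  then show ?thesis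
    using False l by simp
qed

text \<open>Each row of the Vandermonde matrix is a left eigenvector, so every factor of the
  companion matrix scales row \<open>k\<close> by \<open>\<beta> ^ k\<close>. No Vandermonde matrix
  is inverted, so coinciding nodes do no harm.\<close>

lemma scaled_dvm_mult_companion_power:
  fixes p :: "complex poly"
  assumes monic: "lead_coeff p = 1" and deg: "degree p = n"
    and roots: "\<And>k. k < n \<Longrightarrow> poly p (\<beta> ^ k) = 0"
  shows "scaled_dvm n \<beta> * companion_mat p ^\<^sub>m j = mat n n (\<lambda>(k, l). \<beta> ^ (k * (j + l)))"
proof (induction j)
  case 0
  have "dim_row (companion_mat p) = n"
    by (simp add: companion_mat_def deg)
  then show ?case
    by (simp add: scaled_dvm_def)
next
  case (Suc j)
  let ?C = "companion_mat p"
  have C: "?C \<in> carrier_mat n n"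
    by (simp add: companion_mat_def deg)
  have A: "scaled_dvm n \<beta> \<in> carrier_mat n n"
    by (simp add: scaled_dvm_def)
  \<comment> \<open>Matrix powers grow on the right, so associativity splits off the last factor and
    exposes the induction hypothesis.\<close>
  have "scaled_dvm n \<beta> * ?C ^\<^sub>m Suc j = mat n n (\<lambda>(k, l). \<beta> ^ (k * (j + l))) * ?C"
    using assoc_mult_mat[OF A pow_carrier_mat[OF C] C] by (simp add: Suc.IH[symmetric])
  also have "\<dots> = mat n n (\<lambda>(k, l). \<beta> ^ (k * (Suc j + l)))"
  proof (rule eq_matI)
    fix k l
    assume "k < dim_row (mat n n (\<lambda>(k, l). \<beta> ^ (k * (Suc j + l))))"
      and "l < dim_col (mat n n (\<lambda>(k, l). \<beta> ^ (k * (Suc j + l))))"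
    then have k: "k < n" and l: "l < n"
      by simp_all
    have "(mat n n (\<lambda>(k, l). \<beta> ^ (k * (j + l))) * ?C) $$ (k, l)
        = (\<Sum>i<n. \<beta> ^ (k * (j + i)) * ?C $$ (i, l))"
      using k l C by (simp add: scalar_prod_def atLeast0LessThan)
    \<comment> \<open>Row \<open>k\<close> is a multiple of the eigenvector belonging to the root
      \<open>\<beta> ^ k\<close>.\<close>
    also have "\<dots> = \<beta> ^ (k * j) * (\<Sum>i<n. (\<beta> ^ k) ^ i * ?C $$ (i, l))"
      by (simp add: sum_distrib_left power_add power_mult distrib_left mult.assoc)
    also have "\<dots> = \<beta> ^ (k * j) * (\<beta> ^ k * (\<beta> ^ k) ^ l)"
      using companion_mat_left_eigenvector[OF monic roots[OF k]] l by (simp add: deg)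
    also have "\<dots> = \<beta> ^ (k * (Suc j + l))"
      by (simp add: power_add power_mult distrib_left)
    finally show "(mat n n (\<lambda>(k, l). \<beta> ^ (k * (j + l))) * ?C) $$ (k, l)
        = mat n n (\<lambda>(k, l). \<beta> ^ (k * (Suc j + l))) $$ (k, l)"
      using k l by simp
  qed (use C in simp_all)
  finally show ?case .
qed

text \<open>The transpose undoes the reordering: row \<open>i\<close> of the product comes from the
  position that \<open>even_odd_index\<close> sends to \<open>i\<close>, in the first half for even
  \<open>i\<close> and in the second half for odd \<open>i\<close>.\<close>

lemma transpose_even_odd_perm_mat_mult:
  assumes M: "M \<in> carrier_mat (2 * n) c"
  shows "transpose_mat (even_odd_perm_mat (2 * n)) * M
    = mat (2 * n) c (\<lambda>(i, j). M $$ (if even i then i div 2 else n + i div 2, j))"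
proof (rule eq_matI)
  fix i j
  let ?r = "if even i then i div 2 else n + i div 2"
  assume "i < dim_row (mat (2 * n) c (\<lambda>(i, j). M $$ (if even i then i div 2 else n + i div 2, j)))"
    and "j < dim_col (mat (2 * n) c (\<lambda>(i, j). M $$ (if even i then i div 2 else n + i div 2, j)))"
  then have i: "i < 2 * n" and j: "j < c"
    by simp_all
  have r: "?r < 2 * n"
    using i by auto
  \<comment> \<open>This inverts \<open>even_odd_index\<close>, leaving one nonzero term in the sum
    below.\<close>
  have index: "i = even_odd_index (2 * n) r \<longleftrightarrow> r = ?r" if "r < 2 * n" for r
    using i that by (auto simp: even_odd_index_def)
  have "(transpose_mat (even_odd_perm_mat (2 * n)) * M) $$ (i, j)
      = (\<Sum>r<2 * n. (if i = even_odd_index (2 * n) r then 1 else 0) * M $$ (r, j))"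
    using i j M by (simp add: even_odd_perm_mat_def scalar_prod_def atLeast0LessThan)
  also have "\<dots> = (\<Sum>r<2 * n. if r = ?r then M $$ (r, j) else 0)"
    using index by (intro sum.cong) auto
  also have "\<dots> = M $$ (?r, j)"
    using r by simp
  finally show "(transpose_mat (even_odd_perm_mat (2 * n)) * M) $$ (i, j)
      = mat (2 * n) c (\<lambda>(i, j). M $$ (if even i then i div 2 else n + i div 2, j)) $$ (i, j)"
    using i j by simp
qed (use M in \<open>simp_all add: even_odd_perm_mat_def\<close>)

lemma scaled_dvm_even_factorization:
  fixes \<alpha> :: complex and n :: nat
  defines "C \<equiv> companion_mat (\<Prod>k<n. [:- (\<alpha> ^ (2 * k)), 1:])"
    and "D \<equiv> mat_diag n (\<lambda>l. \<alpha> ^ l)"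
  shows "scaled_dvm (2 * n) \<alpha> =
    transpose_mat (even_odd_perm_mat (2 * n))
    * four_block_mat (scaled_dvm n (\<alpha>\<^sup>2)) (0\<^sub>m n n) (0\<^sub>m n n) (scaled_dvm n (\<alpha>\<^sup>2))
    * four_block_mat (1\<^sub>m n) (C ^\<^sub>m n) D (\<alpha> ^ n \<cdot>\<^sub>m (C ^\<^sub>m n * D))"
proof -
  let ?p = "\<Prod>k<n. [:- (\<alpha> ^ (2 * k)), 1:]"
  let ?A = "scaled_dvm n (\<alpha>\<^sup>2)"
  let ?F = "four_block_mat ?A (0\<^sub>m n n) (0\<^sub>m n n) ?A"
  let ?G = "four_block_mat (1\<^sub>m n) (C ^\<^sub>m n) D (\<alpha> ^ n \<cdot>\<^sub>m (C ^\<^sub>m n * D))"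
  let ?B = "mat n n (\<lambda>(k, l). (\<alpha>\<^sup>2) ^ (k * (n + l)))"
  have monic: "lead_coeff ?p = 1"
    by (simp add: lead_coeff_prod)
  have deg: "degree ?p = n"
    by (subst degree_prod_eq_sum_degree) auto
  have roots: "poly ?p ((\<alpha>\<^sup>2) ^ k) = 0" if "k < n" for k
    using that by (auto simp: poly_prod power_mult intro!: bexI[of _ k])
  have A: "?A \<in> carrier_mat n n"
    by (simp add: scaled_dvm_def)
  have C: "C ^\<^sub>m n \<in> carrier_mat n n"
    by (rule pow_carrier_mat) (simp add: C_def companion_mat_def deg)
  have D: "D \<in> carrier_mat n n"
    by (simp add: D_def mat_diag_def)
  \<comment> \<open>With exactly \<open>n\<close> factors the exponents in \<open>?B\<close> start
    where those of \<open>?A\<close> stop: side by side, the two blocks have entries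
    \<open>(\<alpha>\<^sup>2) ^ (k * j)\<close> for all \<open>j < 2 * n\<close>.\<close>
  have AC: "?A * C ^\<^sub>m n = ?B"
    unfolding C_def by (rule scaled_dvm_mult_companion_power[OF monic deg roots])
  have ACD: "?A * (\<alpha> ^ n \<cdot>\<^sub>m (C ^\<^sub>m n * D)) = \<alpha> ^ n \<cdot>\<^sub>m (?B * D)"
    using mult_smult_distrib[OF A mult_carrier_mat[OF C D]] assoc_mult_mat[OF A C D] AC by simp
  have CD: "\<alpha> ^ n \<cdot>\<^sub>m (C ^\<^sub>m n * D) \<in> carrier_mat n n"
    using C D by simp
  have BD_carrier: "\<alpha> ^ n \<cdot>\<^sub>m (?B * D) \<in> carrier_mat n n"
    using D by (intro smult_carrier_mat mult_carrier_mat) simp_all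
  have FG: "?F * ?G = four_block_mat ?A ?B (?A * D) (\<alpha> ^ n \<cdot>\<^sub>m (?B * D))"
    using A C D CD
    by (subst mult_four_block_mat[OF A zero_carrier_mat zero_carrier_mat A one_carrier_mat C D CD])
      (simp add: AC ACD left_mult_zero_mat[OF C] left_mult_zero_mat[OF CD]
        left_add_zero_mat[OF BD_carrier])
  have P: "transpose_mat (even_odd_perm_mat (2 * n)) \<in> carrier_mat (2 * n) (2 * n)"
    by (simp add: even_odd_perm_mat_def)
  have F: "?F \<in> carrier_mat (2 * n) (2 * n)"
    using four_block_carrier_mat[OF A A] by (simp add: mult_2)
  have G: "?G \<in> carrier_mat (2 * n) (2 * n)"
    using four_block_carrier_mat[OF one_carrier_mat CD] by (simp add: mult_2)
  have "transpose_mat (even_odd_perm_mat (2 * n)) * ?F * ?G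
      = mat (2 * n) (2 * n) (\<lambda>(i, j). (?F * ?G) $$ (if even i then i div 2 else n + i div 2, j))"
    using transpose_even_odd_perm_mat_mult[OF mult_carrier_mat[OF F G]]
    by (simp only: assoc_mult_mat[OF P F G])
  also have "\<dots> = scaled_dvm (2 * n) \<alpha>"
  proof (rule eq_matI)
    fix i j
    assume "i < dim_row (scaled_dvm (2 * n) \<alpha>)" and "j < dim_col (scaled_dvm (2 * n) \<alpha>)"
    then have i: "i < 2 * n" and j: "j < 2 * n"
      by (simp_all add: scaled_dvm_def)
    have AD: "?A * D = mat n n (\<lambda>(k, l). ?A $$ (k, l) * \<alpha> ^ l)"
      unfolding D_def by (rule mat_diag_mult_right[OF A])
    have BD: "?B * D = mat n n (\<lambda>(k, l). ?B $$ (k, l) * \<alpha> ^ l)"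
      unfolding D_def by (rule mat_diag_mult_right) simp
    have half: "i div 2 < n"
      using i by simp
    have "(?F * ?G) $$ (if even i then i div 2 else n + i div 2, j) = \<alpha> ^ (i * j)"
    proof (cases "even i")
      case True
      then obtain k where k: "i = 2 * k" ..
      have "(?F * ?G) $$ (k, j) = (\<alpha>\<^sup>2) ^ (k * j)"
        unfolding FG AD BD using half j k by (simp add: scaled_dvm_def)
      then show ?thesis
        by (simp add: k mult.assoc flip: power_mult)
    next
      case False
      then obtain k where k: "i = 2 * k + 1" ..
      \<comment> \<open>For \<open>j < n\<close> the factor \<open>\<alpha> ^ j\<close> comes from
        \<open>D\<close> alone. For \<open>j = n + l\<close> it is the scalar
        \<open>\<alpha> ^ n\<close> times the entry \<open>\<alpha> ^ l\<close> of
        \<open>D\<close>.\<close>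
      have "(?F * ?G) $$ (n + k, j) = (\<alpha>\<^sup>2) ^ (k * j) * \<alpha> ^ j"
        unfolding FG AD BD using half j k
        by (simp add: scaled_dvm_def flip: power_add)
      then show ?thesis
        by (simp add: k algebra_simps flip: power_mult power_add)
    qed
    then show "mat (2 * n) (2 * n)
        (\<lambda>(i, j). (?F * ?G) $$ (if even i then i div 2 else n + i div 2, j)) $$ (i, j)
        = scaled_dvm (2 * n) \<alpha> $$ (i, j)"
      using i j by (simp add: scaled_dvm_def)
  qed (simp_all add: scaled_dvm_def)
  finally show ?thesis ..
qed

theorem lemma3p1:
  fixes t N :: nat and \<alpha> :: complex and C D :: "complex mat"
  assumes "t \<ge> 1" and "N = 2 ^ t"
  defines "C \<equiv> companion_mat (\<Prod>k<N div 2. [:- (\<alpha> ^ (2 * k)), 1:])"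
    and "D \<equiv> mat_diag (N div 2) (\<lambda>l. \<alpha> ^ l)"
  shows "scaled_dvm N \<alpha> =
    transpose_mat (even_odd_perm_mat N)
    * four_block_mat
        (scaled_dvm (N div 2) (\<alpha>\<^sup>2)) (0\<^sub>m (N div 2) (N div 2))
        (0\<^sub>m (N div 2) (N div 2)) (scaled_dvm (N div 2) (\<alpha>\<^sup>2))
    * four_block_mat
        (1\<^sub>m (N div 2)) (C ^\<^sub>m (N div 2))
        D (\<alpha> ^ (N div 2) \<cdot>\<^sub>m (C ^\<^sub>m (N div 2) * D))"
proof -
  \<comment> \<open>The bound on \<open>t\<close> excludes \<open>N = 1\<close>, the only odd power
    of two.\<close>
  have "N = 2 * (N div 2)"
    using assms(1,2) by (cases t) simp_all
  then show ?thesis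
    using scaled_dvm_even_factorization[of "N div 2" \<alpha>] unfolding C_def D_def by simp
qed

end
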